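(* Let $z_k=k^2$ for $k\ge1$, let $\frac{1}{\tilde z_k}=\sum_{i=1}^{k-1}\frac{1}{z_i-z_k}+\sum_{i=k+1}^{\infty}\left(\frac{1}{z_i-z_k}-\frac{1}{z_i}\right)$ and $\tilde\zeta_{\mathcal Z}(s)=\sum_{n\ge1}\frac{1}{\tilde z_nz_n^{s-1}}$. Then $$\frac{1}{\tilde z_k}=\frac{3}{4k^2}-\psi'(k+1)\quad(k\ge1),$$ and for real $s>3/2$, $$\tilde\zeta_{\mathcal Z}(s)=\frac74\zeta(2s)-\zeta(2)\zeta(2s-2)+\zeta(2s-2,2),$$ where $\zeta$ is the Riemann zeta function and $\zeta(a,b)=\sum_{n>m\ge1}n^{-a}m^{-b}$.
   Context: $\psi'$ is the derivative of the digamma function $\psi=\Gamma'/\Gamma$ (trigamma function). *)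

theory Defs
  imports "HOL-Analysis.Analysis"
begin

text \<open>
  Sequences \<open>z\<close> are indexed from \<open>1\<close>; the value \<open>z 0\<close> is never used.
\<close>

definition tilde_term :: "(nat \<Rightarrow> real) \<Rightarrow> nat \<Rightarrow> nat \<Rightarrow> real" where
  "tilde_term z k i = 1 / (z i - z k) - 1 / z i"

text \<open>
  This is the quantity written \<open>1 / z\<close>-tilde, not its reciprocal. In the infinite part
  the index \<open>i \<ge> k + 1\<close> is written as \<open>k + 1 + j\<close> with \<open>j \<ge> 0\<close>.
\<close>

definition inv_tilde :: "(nat \<Rightarrow> real) \<Rightarrow> nat \<Rightarrow> real" where
  "inv_tilde z k = (\<Sum>i=1..k-1. 1 / (z i - z k)) + (\<Sum>j. tilde_term z k (k + 1 + j))"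

definition tilde_zeta_term :: "(nat \<Rightarrow> real) \<Rightarrow> real \<Rightarrow> nat \<Rightarrow> real" where
  "tilde_zeta_term z s n = inv_tilde z n / z n powr (s - 1)"

definition tilde_zeta :: "(nat \<Rightarrow> real) \<Rightarrow> real \<Rightarrow> real" where
  "tilde_zeta z s = (\<Sum>n. tilde_zeta_term z s (Suc n))"

text \<open>
  The Riemann zeta function as its Dirichlet series; meaningful only for real \<open>a > 1\<close>.
\<close>

definition riemann_zeta :: "real \<Rightarrow> real" where
  "riemann_zeta a = (\<Sum>n. 1 / real (Suc n) powr a)"

definition double_zeta_index :: "(nat \<times> nat) set" where
  "double_zeta_index = {(n, m). n > m \<and> m \<ge> 1}"

definition double_zeta_term :: "real \<Rightarrow> real \<Rightarrow> nat \<times> nat \<Rightarrow> real" where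
  "double_zeta_term a b = (\<lambda>(n, m). real n powr (- a) * real m powr (- b))"

definition double_zeta :: "real \<Rightarrow> real \<Rightarrow> real" where
  "double_zeta a b = infsum (double_zeta_term a b) double_zeta_index"

end

theory Submission
  imports Defs
begin

text \<open>
  Partial fractions turn \<open>1 / (i\<^sup>2 - k\<^sup>2)\<close> into \<open>1 / (2k)\<close> times a difference of reciprocals. The
  sum over \<open>i > k\<close> telescopes to \<open>H(2k) / (2k)\<close>, while the sum over \<open>i < k\<close> equals
  \<open>-(H(2k) - 3 / (2k)) / (2k)\<close>, where \<open>H\<close> denotes harmonic numbers. Hence the two parts together
  give \<open>3 / (4k\<^sup>2)\<close>, and the correction terms \<open>1 / i\<^sup>2\<close> add up to the trigamma value. Writing that
  value as \<open>\<zeta>(2)\<close> minus a partial sum and multiplying by \<open>k powr (2 - 2s)\<close>, the diagonal term of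
  the partial sum contributes a further \<open>\<zeta>(2s)\<close>, and the remaining terms form the double zeta value.
\<close>

text \<open>Induction on the shift: passing from \<open>m\<close> to \<open>Suc m\<close> adds the
  ordinary telescoping series of \<open>f (n + m)\<close>, whose sum is \<open>f m\<close> because
  \<open>f\<close> tends to 0.\<close>

lemma telescope_sums_shift:
  fixes f :: "nat \<Rightarrow> 'a::real_normed_vector"
  assumes "f \<longlonglongrightarrow> 0"
  shows "(\<lambda>n. f n - f (n + m)) sums (\<Sum>i<m. f i)"
proof (induction m)
  case (Suc m)
  have "(\<lambda>n. f (n + m)) \<longlonglongrightarrow> 0"
    using assms by (rule LIMSEQ_ignore_initial_segment)
  from sums_add[OF Suc.IH telescope_sums'[OF this]] show ?case
    by simp
qed simp

lemma sums_inverse_square_diff: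
  assumes "k \<ge> 1"
  shows "(\<lambda>j. 1 / ((real (k + 1 + j))\<^sup>2 - (real k)\<^sup>2)) sums (harm (2 * k) / (2 * real k))"
proof -
  define f where "f j = inverse (real (Suc j))" for j
  have "f \<longlonglongrightarrow> 0"
    unfolding f_def by (rule LIMSEQ_inverse_real_of_nat)
  then have "(\<lambda>n. f n - f (n + 2 * k)) sums (\<Sum>i<2 * k. f i)"
    by (rule telescope_sums_shift)
  also have "(\<Sum>i<2 * k. f i) = harm (2 * k)"
    unfolding harm_def f_def by (simp add: sum.atLeast1_atMost_eq)
  finally have *: "(\<lambda>n. (f n - f (n + 2 * k)) / (2 * real k)) sums (harm (2 * k) / (2 * real k))"
    by (rule sums_divide)
  \<comment> \<open>For \<open>i = k + 1 + j\<close> the factors are \<open>i - k = j + 1\<close>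
    and \<open>i + k = j + 2 * k + 1\<close>; since \<open>f\<close> is indexed from 0, their
    reciprocals are \<open>f j\<close> and \<open>f (j + 2 * k)\<close>.\<close>
  have "(f j - f (j + 2 * k)) / (2 * real k) = 1 / ((real (k + 1 + j))\<^sup>2 - (real k)\<^sup>2)" for j
  proof -
    have "(real (k + 1 + j))\<^sup>2 - (real k)\<^sup>2 = (1 + real j) * (1 + real j + 2 * real k)"
      by (simp add: power2_eq_square algebra_simps)
    moreover have "1 + real j \<noteq> 0" "1 + real j + 2 * real k \<noteq> 0" "real k \<noteq> 0"
      using assms by auto
    ultimately show ?thesis
      by (simp add: f_def divide_simps add_ac)
  qed
  with * show ?thesis by simp
qed

text \<open>In the partial fractions, \<open>k - i\<close> runs through 1, ..., k - 1 and
  \<open>k + i\<close> through k + 1, ..., 2k - 1. Only 1/k and 1/(2k) are missing from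
  \<open>harm (2 * k)\<close>, which explains the 3/(2k).\<close>

lemma sum_inverse_square_diff:
  assumes "k \<ge> 1"
  shows "(\<Sum>i=1..k-1. 1 / ((real i)\<^sup>2 - (real k)\<^sup>2)) =
           (3 / (2 * real k) - harm (2 * k)) / (2 * real k)"
proof -
  obtain n where k: "k = Suc n"
    using assms by (cases k) auto
  have "1 / ((real i)\<^sup>2 - (real k)\<^sup>2) =
          - (inverse (real (k - i)) + inverse (real (i + k))) / (2 * real k)"
    if "i \<in> {1..n}" for i
  proof -
    have "real k - real i \<noteq> 0" "real k + real i \<noteq> 0" "real k \<noteq> 0"
      using that k by auto
    moreover have "(real i)\<^sup>2 - (real k)\<^sup>2 = - ((real k - real i) * (real k + real i))"
      by (simp add: power2_eq_square algebra_simps)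
    ultimately show ?thesis
      using that k by (simp add: of_nat_diff divide_simps)
  qed
  then have "(\<Sum>i=1..n. 1 / ((real i)\<^sup>2 - (real k)\<^sup>2)) =
      (\<Sum>i=1..n. - (inverse (real (k - i)) + inverse (real (i + k))) / (2 * real k))"
    by (intro sum.cong) auto
  also have "\<dots> = - ((\<Sum>i=1..n. inverse (real (k - i))) + (\<Sum>i=1..n. inverse (real (i + k))))
                    / (2 * real k)"
    by (simp only: sum.distrib sum_negf flip: sum_divide_distrib)
  also have "(\<Sum>i=1..n. inverse (real (k - i))) = harm n"
    unfolding harm_def k
    by (rule sum.reindex_bij_witness[of _ "\<lambda>i. Suc n - i" "\<lambda>i. Suc n - i"]) auto
  also have "(\<Sum>i=1..n. inverse (real (i + k))) = harm (k + n) - harm k"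
  proof -
    \<comment> \<open>The length \<open>m\<close> is decoupled from \<open>n\<close>, so that
      \<open>k\<close> stays fixed during the induction.\<close>
    have "harm (k + m) = harm k + (\<Sum>i=1..m. inverse (real (i + k)))" for m
      by (induction m) (simp_all add: harm_Suc add_ac)
    then show ?thesis by simp
  qed
  also have "harm n + (harm (k + n) - harm k) = harm (2 * k) - 3 / (2 * real k)"
  proof -
    have "harm (2 * k) = harm (k + n) + inverse (2 * real k)"
    proof -
      have "2 * k = Suc (k + n)" by (simp add: k)
      then show ?thesis by (metis harm_Suc of_nat_mult of_nat_numeral)
    qed
    moreover have "harm k = harm n + inverse (real k)"
      by (simp add: k harm_Suc)
    ultimately show ?thesis
      using assms by (simp add: field_simps)
  qed
  finally show ?thesis by (simp add: k)
qed

lemma trigamma_sums: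
  "(\<lambda>j. 1 / (real (k + 1 + j))\<^sup>2) sums deriv Digamma (real k + 1)"
proof -
  have "real k + 1 \<notin> \<int>\<^sub>\<le>\<^sub>0"
    by (auto elim!: nonpos_Ints_cases)
  then have "deriv Digamma (real k + 1) = Polygamma (Suc 0) (real k + 1)"
    by (rule deriv_Polygamma)
  \<comment> \<open>At order 1 the sign is (-1)^2 and the factorial is 1!, so the general polygamma
    series has the plain trigamma value as its sum.\<close>
  moreover have "(\<lambda>j. inverse ((real k + 1 + real j) ^ Suc (Suc 0))) sums
      ((-1) ^ Suc (Suc 0) * Polygamma (Suc 0) (real k + 1) / fact (Suc 0))"
    by (rule Polygamma_LIMSEQ) auto
  ultimately show ?thesis
    by (simp add: power2_eq_square inverse_eq_divide add_ac)
qed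

lemma tilde_term_squares_sums:
  assumes z: "\<And>k. k \<ge> 1 \<Longrightarrow> z k = (real k)\<^sup>2" and k: "k \<ge> 1"
  shows "(\<lambda>j. tilde_term z k (k + 1 + j)) sums
           (harm (2 * k) / (2 * real k) - deriv Digamma (real k + 1))"
proof -
  have "tilde_term z k (k + 1 + j) =
      1 / ((real (k + 1 + j))\<^sup>2 - (real k)\<^sup>2) - 1 / (real (k + 1 + j))\<^sup>2" for j
    using z[of k] z[of "k + 1 + j"] k by (simp add: tilde_term_def)
  then show ?thesis
    by (simp only:) (intro sums_diff sums_inverse_square_diff trigamma_sums k)
qed

lemma inv_tilde_squares:
  assumes z: "\<And>k. k \<ge> 1 \<Longrightarrow> z k = (real k)\<^sup>2" and k: "k \<ge> 1"
  shows "inv_tilde z k = 3 / (4 * (real k)\<^sup>2) - deriv Digamma (real k + 1)"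
proof -
  have "(\<Sum>i=1..k-1. 1 / (z i - z k)) = (\<Sum>i=1..k-1. 1 / ((real i)\<^sup>2 - (real k)\<^sup>2))"
    using z k by (intro sum.cong) auto
  moreover have "(\<Sum>j. tilde_term z k (k + 1 + j)) =
      harm (2 * k) / (2 * real k) - deriv Digamma (real k + 1)"
    using tilde_term_squares_sums[OF z k] by (simp add: sums_iff)
  ultimately show ?thesis
    unfolding inv_tilde_def sum_inverse_square_diff[OF k]
    by (simp add: power2_eq_square diff_divide_distrib)
qed

lemma riemann_zeta_sums:
  assumes "a > 1"
  shows "(\<lambda>n. real (Suc n) powr (- a)) sums riemann_zeta a"
proof -
  have "summable (\<lambda>n. real n powr (- a))"
    using assms by (simp add: summable_real_powr_iff)
  then have "summable (\<lambda>n. real (Suc n) powr (- a))"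
    by (subst summable_Suc_iff)
  moreover have "riemann_zeta a = (\<Sum>n. real (Suc n) powr (- a))"
    unfolding riemann_zeta_def by (simp add: powr_minus_divide)
  ultimately show ?thesis
    by (simp add: sums_iff)
qed

text \<open>The trigamma series at \<open>k + 1\<close> is the tail of the series for \<zeta>(2)
  after \<open>k\<close> terms. The removed partial sum later supplies the inner sum of the double
  zeta value.\<close>

lemma trigamma_eq_riemann_zeta_diff:
  "deriv Digamma (real k + 1) = riemann_zeta 2 - (\<Sum>m=1..k. real m powr (- 2))"
proof -
  have "(\<lambda>j. real (Suc (j + k)) powr (- 2)) sums
          (riemann_zeta 2 - (\<Sum>j<k. real (Suc j) powr (- 2)))"
    by (intro sums_split_initial_segment[where f = "\<lambda>n. real (Suc n) powr (- 2)"]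
              riemann_zeta_sums) auto
  moreover have "real (Suc (j + k)) powr (- 2) = 1 / (real (k + 1 + j))\<^sup>2" for j
    by (simp add: powr_minus_divide add_ac)
  moreover have "(\<Sum>j<k. real (Suc j) powr (- 2)) = (\<Sum>m=1..k. real m powr (- 2))"
    by (simp add: sum.atLeast1_atMost_eq)
  ultimately show ?thesis
    using trigamma_sums[of k] by (metis (no_types, lifting) sums_cong sums_unique2)
qed

text \<open>Converts the unordered sum over pairs into a series over the larger index. The terms are
  nonnegative, so convergence of the iterated sum suffices; bounding the inner sums by
  \<open>riemann_zeta b\<close> reduces it to the series of
  \<open>real n powr (- a)\<close>.\<close>

lemma double_zeta_sums:
  assumes a: "a > 1" and b: "b > 1"
  shows "double_zeta_term a b summable_on double_zeta_index"
    and "(\<lambda>n. real (Suc n) powr (- a) * (\<Sum>m=1..n. real m powr (- b))) sums double_zeta a b"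
proof -
  define g where "g n = real n powr (- a) * (\<Sum>m=1..<n. real m powr (- b))" for n
  have index: "double_zeta_index = Sigma UNIV (\<lambda>n. {1..<n})"
    by (auto simp: double_zeta_index_def)
  have g_nonneg: "g n \<ge> 0" for n
    unfolding g_def by (intro mult_nonneg_nonneg sum_nonneg) auto
  have partial_le: "(\<Sum>m=1..<n. real m powr (- b)) \<le> riemann_zeta b" for n
  proof -
    \<comment> \<open>At \<open>n = 0\<close> the truncated difference is 0 and both sums are
      empty.\<close>
    have "(\<Sum>m=1..<n. real m powr (- b)) = (\<Sum>m<n-1. real (Suc m) powr (- b))"
      by (rule sum.reindex_bij_witness[of _ Suc "\<lambda>m. m - 1"]) auto
    also have "\<dots> \<le> riemann_zeta b"
      unfolding sums_unique[OF riemann_zeta_sums[OF b]]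
      by (intro sum_le_suminf sums_summable[OF riemann_zeta_sums[OF b]]) auto
    finally show ?thesis .
  qed
  have "summable (\<lambda>n. real n powr (- a) * riemann_zeta b)"
    using a by (intro summable_mult2) (simp add: summable_real_powr_iff)
  then have "summable g"
  proof (rule summable_comparison_test'[where N = 0])
    show "norm (g n) \<le> real n powr (- a) * riemann_zeta b" for n
      using g_nonneg[of n] partial_le[of n] by (simp add: g_def mult_left_mono)
  qed
  then have g_sum: "(g has_sum suminf g) UNIV"
    by (intro sums_nonneg_imp_has_sum summable_sums g_nonneg)
  have inner: "((\<lambda>m. double_zeta_term a b (n, m)) has_sum g n) {1..<n}" for n
    by (auto simp: double_zeta_term_def g_def sum_distrib_left intro!: has_sum_finiteI)
  show "double_zeta_term a b summable_on double_zeta_index"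
    unfolding index
  proof (rule summable_on_SigmaI[OF inner])
    show "g summable_on UNIV"
      using g_sum by (rule has_sum_imp_summable)
  qed (simp add: double_zeta_term_def)
  then have "double_zeta a b = suminf g"
    unfolding double_zeta_def index by (intro infsumI has_sum_SigmaI[OF inner g_sum])
  with \<open>summable g\<close> have "g sums double_zeta a b"
    by (simp add: sums_iff)
  \<comment> \<open>The vanishing first term allows the shift to \<open>Suc n\<close>, under which
    the range \<open>{1..<n}\<close> turns into \<open>{1..n}\<close>.\<close>
  moreover have "g 0 = 0"
    by (simp add: g_def)
  ultimately have "(\<lambda>n. g (Suc n)) sums double_zeta a b"
    by (simp add: sums_Suc_iff)
  then show "(\<lambda>n. real (Suc n) powr (- a) * (\<Sum>m=1..n. real m powr (- b))) sums double_zeta a b"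
    by (simp add: g_def atLeastLessThanSuc_atLeastAtMost del: of_nat_Suc)
qed

lemma tilde_zeta_term_squares:
  assumes z: "\<And>k. k \<ge> 1 \<Longrightarrow> z k = (real k)\<^sup>2"
  shows "tilde_zeta_term z s (Suc n) =
           7 / 4 * real (Suc n) powr (- (2 * s))
           - riemann_zeta 2 * real (Suc n) powr (- (2 * s - 2))
           + real (Suc n) powr (- (2 * s - 2)) * (\<Sum>m=1..n. real m powr (- 2))"
proof -
  define x where "x = real (Suc n)"
  define w where "w = x powr (- (2 * s - 2))"
  define S where "S = (\<Sum>m=1..n. real m powr (- 2))"
  have x: "x > 0" by (simp add: x_def)
  have "z (Suc n) powr (s - 1) = (x powr 2) powr (s - 1)"
    using z[of "Suc n"] x by (simp add: x_def)
  also have "\<dots> = x powr (2 * s - 2)"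
    by (simp add: powr_powr algebra_simps)
  finally have "1 / z (Suc n) powr (s - 1) = w"
    unfolding w_def by (simp only: powr_minus_divide)
  \<comment> \<open>The partial sum of \<zeta>(2) ends at \<open>m = Suc n\<close>, whereas the
    double zeta value needs \<open>m < Suc n\<close>. Splitting off the last term leaves
    \<open>S\<close> and raises the coefficient 3/4 to 7/4.\<close>
  moreover have "inv_tilde z (Suc n) = 3 / 4 * x powr (- 2) - (riemann_zeta 2 - (S + x powr (- 2)))"
    using inv_tilde_squares[OF z, of "Suc n"] trigamma_eq_riemann_zeta_diff[of "Suc n"] x
    by (simp add: S_def x_def powr_minus_divide)
  ultimately have "tilde_zeta_term z s (Suc n) =
      (3 / 4 * x powr (- 2) - (riemann_zeta 2 - (S + x powr (- 2)))) * w"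
    by (metis tilde_zeta_term_def divide_inverse inverse_eq_divide)
  also have "\<dots> = 7 / 4 * (x powr (- 2) * w) - riemann_zeta 2 * w + w * S"
    by (simp add: algebra_simps)
  also have "x powr (- 2) * w = x powr (- (2 * s))"
    by (simp add: w_def flip: powr_add)
  finally show ?thesis
    by (simp add: w_def S_def x_def)
qed

theorem theorem4p3:
  fixes z :: "nat \<Rightarrow> real"
  assumes "\<And>k. k \<ge> 1 \<Longrightarrow> z k = (real k)\<^sup>2"
  shows "(\<forall>k\<ge>1. summable (\<lambda>j. tilde_term z k (k + 1 + j)) \<and>
             inv_tilde z k = 3 / (4 * (real k)\<^sup>2) - deriv Digamma (real k + 1)) \<and>
         (\<forall>s>3/2. summable (\<lambda>n. tilde_zeta_term z s (Suc n)) \<and>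
             double_zeta_term (2 * s - 2) 2 summable_on double_zeta_index \<and>
             tilde_zeta z s = 7 / 4 * riemann_zeta (2 * s)
               - riemann_zeta 2 * riemann_zeta (2 * s - 2) + double_zeta (2 * s - 2) 2)"
proof (intro conjI allI impI)
  fix k :: nat
  assume k: "k \<ge> 1"
  show "summable (\<lambda>j. tilde_term z k (k + 1 + j))"
    using tilde_term_squares_sums[OF assms k] by (rule sums_summable)
  show "inv_tilde z k = 3 / (4 * (real k)\<^sup>2) - deriv Digamma (real k + 1)"
    using assms k by (rule inv_tilde_squares)
next
  fix s :: real
  assume s: "s > 3 / 2"
  then show "double_zeta_term (2 * s - 2) 2 summable_on double_zeta_index"
    by (intro double_zeta_sums(1)) auto
  have term_eq: "tilde_zeta_term z s (Suc n) =
      7 / 4 * real (Suc n) powr (- (2 * s))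
      - riemann_zeta 2 * real (Suc n) powr (- (2 * s - 2))
      + real (Suc n) powr (- (2 * s - 2)) * (\<Sum>m=1..n. real m powr (- 2))" for n
    using assms by (rule tilde_zeta_term_squares)
  \<comment> \<open>The bound \<open>s > 3 / 2\<close> amounts to \<open>2 * s - 2 > 1\<close>, so
    all three series converge and can be added termwise.\<close>
  have "(\<lambda>n. tilde_zeta_term z s (Suc n)) sums
          (7 / 4 * riemann_zeta (2 * s) - riemann_zeta 2 * riemann_zeta (2 * s - 2)
           + double_zeta (2 * s - 2) 2)"
    unfolding term_eq using s by (intro sums_add sums_diff sums_mult riemann_zeta_sums double_zeta_sums(2)) auto
  then show "summable (\<lambda>n. tilde_zeta_term z s (Suc n))"
    and "tilde_zeta z s = 7 / 4 * riemann_zeta (2 * s)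
           - riemann_zeta 2 * riemann_zeta (2 * s - 2) + double_zeta (2 * s - 2) 2"
    by (simp_all add: sums_iff tilde_zeta_def)
qed

end
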